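(* Let $X$ be a zero-dimensional Hausdorff space. For any (proper) ideal $I$ in $C_c(X)$, the closure of $I$ in the $m_c$-topology on $C_c(X)$ equals $\overline{I}$, the intersection of all maximal ideals of $C_c(X)$ which contain $I$.
   Context: A space is zero-dimensional if its clopen sets form a base for its topology. $C_c(X)$ is the ring of real-valued continuous functions on $X$ with countable range. The $m_c$-topology on $C_c(X)$ is the topology with open base consisting of all sets $M(g,u)=\{f\in C_c(X): |f(x)-g(x)|<u(x)\text{ for each }x\in X\}$, where $g\in C_c(X)$ and $u$ is a positive unit of $C_c(X)$ (a unit with $u(x)>0$ for all $x$). *)

theory Defs
  imports "HOL-Analysis.Analysis" "HOL-Algebra.Ideal"
begin

definition zero_dimensional_space :: "'a topology \<Rightarrow> bool" where
  "zero_dimensional_space X \<longleftrightarrow>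
     openin X = arbitrary union_of (\<lambda>U. openin X U \<and> closedin X U)"

text \<open>The ring \<open>C\<^sub>c(X)\<close>. Its elements are taken to be extensional (i.e. equal to \<open>undefined\<close>
  outside \<open>topspace X\<close>), so that equality of elements is equality of functions on \<open>X\<close>.\<close>

definition Cc_carrier :: "'a topology \<Rightarrow> ('a \<Rightarrow> real) set" where
  "Cc_carrier X =
     {f \<in> extensional (topspace X). continuous_map X euclideanreal f \<and> countable (f ` topspace X)}"

definition Cc :: "'a topology \<Rightarrow> ('a \<Rightarrow> real) ring" where
  "Cc X = \<lparr>carrier = Cc_carrier X,
           mult = (\<lambda>f g. \<lambda>x\<in>topspace X. f x * g x),
           one = (\<lambda>x\<in>topspace X. 1),
           zero = (\<lambda>x\<in>topspace X. 0),
           add = (\<lambda>f g. \<lambda>x\<in>topspace X. f x + g x)\<rparr>"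

definition positive_units :: "'a topology \<Rightarrow> ('a \<Rightarrow> real) set" where
  "positive_units X = {u \<in> Units (Cc X). \<forall>x\<in>topspace X. 0 < u x}"

definition mc_nbhd :: "'a topology \<Rightarrow> ('a \<Rightarrow> real) \<Rightarrow> ('a \<Rightarrow> real) \<Rightarrow> ('a \<Rightarrow> real) set" where
  "mc_nbhd X g u = {f \<in> carrier (Cc X). \<forall>x\<in>topspace X. \<bar>f x - g x\<bar> < u x}"

definition mc_base :: "'a topology \<Rightarrow> ('a \<Rightarrow> real) set \<Rightarrow> bool" where
  "mc_base X B \<longleftrightarrow> (\<exists>g\<in>carrier (Cc X). \<exists>u\<in>positive_units X. B = mc_nbhd X g u)"

definition mc_topology :: "'a topology \<Rightarrow> ('a \<Rightarrow> real) topology" where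
  "mc_topology X = topology (arbitrary union_of mc_base X)"

definition max_ideal_hull :: "'a topology \<Rightarrow> ('a \<Rightarrow> real) set \<Rightarrow> ('a \<Rightarrow> real) set" where
  "max_ideal_hull X I = \<Inter>{M. maximalideal M (Cc X) \<and> I \<subseteq> M}"


text \<open>The locale \<^locale>\<open>ideal\<close> includes the ring axioms, and \<open>topology\<close> is only meaningful
  for families satisfying \<open>istopology\<close>; both requirements are discharged below.\<close>

lemma Cc_carrierI:
  assumes "continuous_map X euclideanreal f" "countable (f ` topspace X)"
  shows "restrict f (topspace X) \<in> Cc_carrier X"
proof -
  have "continuous_map X euclideanreal (restrict f (topspace X))"
    using assms(1) by (rule continuous_map_eq) simp
  with assms(2) show ?thesis
    by (simp add: Cc_carrier_def)
qed

lemma Cc_carrierD: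
  assumes "f \<in> Cc_carrier X"
  shows "continuous_map X euclideanreal f" "countable (f ` topspace X)"
    "f \<in> extensional (topspace X)"
  using assms by (auto simp: Cc_carrier_def)

lemma countable_image2:
  assumes "countable (f ` A)" "countable (g ` A)"
  shows "countable ((\<lambda>x. h (f x) (g x)) ` A)"
proof (rule countable_subset)
  show "(\<lambda>x. h (f x) (g x)) ` A \<subseteq> (\<lambda>(y, z). h y z) ` (f ` A \<times> g ` A)"
    by auto
  show "countable ((\<lambda>(y, z). h y z) ` (f ` A \<times> g ` A))"
    using assms by auto
qed

lemma Cc_closed:
  assumes f: "f \<in> Cc_carrier X" and g: "g \<in> Cc_carrier X"
  shows "(\<lambda>x\<in>topspace X. f x + g x) \<in> Cc_carrier X"
    and "(\<lambda>x\<in>topspace X. f x * g x) \<in> Cc_carrier X"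
    and "(\<lambda>x\<in>topspace X. - f x) \<in> Cc_carrier X"
proof -
  note C = Cc_carrierD[OF f] Cc_carrierD[OF g]
  show "(\<lambda>x\<in>topspace X. f x + g x) \<in> Cc_carrier X"
    using C by (intro Cc_carrierI continuous_map_add countable_image2[of f _ g "(+)"])
  show "(\<lambda>x\<in>topspace X. f x * g x) \<in> Cc_carrier X"
    using C by (intro Cc_carrierI continuous_map_real_mult countable_image2[of f _ g "(*)"])
  show "(\<lambda>x\<in>topspace X. - f x) \<in> Cc_carrier X"
    using C by (intro Cc_carrierI continuous_map_minus countable_image2[of f _ f "\<lambda>y z. - y"])
qed

lemma Cc_const: "(\<lambda>x\<in>topspace X. c) \<in> Cc_carrier X"
  by (rule Cc_carrierI) (auto simp: image_constant_conv)

lemma cring_Cc: "cring (Cc X)"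
proof (rule cringI)
  show "abelian_group (Cc X)"
  proof (rule abelian_groupI)
    fix f assume "f \<in> carrier (Cc X)"
    then show "\<exists>g\<in>carrier (Cc X). g \<oplus>\<^bsub>Cc X\<^esub> f = \<zero>\<^bsub>Cc X\<^esub>"
      by (intro bexI[of _ "\<lambda>x\<in>topspace X. - f x"]) (auto simp: Cc_def Cc_closed)
  next
    fix f assume "f \<in> carrier (Cc X)"
    then show "\<zero>\<^bsub>Cc X\<^esub> \<oplus>\<^bsub>Cc X\<^esub> f = f"
      by (auto simp: Cc_def Cc_carrier_def extensional_def fun_eq_iff)
  qed (auto simp: Cc_def Cc_closed Cc_const fun_eq_iff)
  show "comm_monoid (Cc X)"
  proof (rule comm_monoidI)
    fix f assume "f \<in> carrier (Cc X)"
    then show "\<one>\<^bsub>Cc X\<^esub> \<otimes>\<^bsub>Cc X\<^esub> f = f"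
      by (auto simp: Cc_def Cc_carrier_def extensional_def fun_eq_iff)
  qed (auto simp: Cc_def Cc_closed Cc_const fun_eq_iff)
qed (auto simp: Cc_def fun_eq_iff algebra_simps)

lemma positive_units_iff:
  "u \<in> positive_units X \<longleftrightarrow> u \<in> Cc_carrier X \<and> (\<forall>x\<in>topspace X. 0 < u x)"
proof
  assume u: "u \<in> Cc_carrier X \<and> (\<forall>x\<in>topspace X. 0 < u x)"
  define v where "v = (\<lambda>x\<in>topspace X. inverse (u x))"
  have "v \<in> Cc_carrier X"
    unfolding v_def
  proof (rule Cc_carrierI)
    show "continuous_map X euclideanreal (\<lambda>x. inverse (u x))"
      using u by (intro continuous_map_real_inverse) (auto dest: Cc_carrierD)
    show "countable ((\<lambda>x. inverse (u x)) ` topspace X)"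
      using u countable_image[of "u ` topspace X" inverse] by (auto dest: Cc_carrierD simp: image_image)
  qed
  moreover have "(\<lambda>x\<in>topspace X. u x * v x) = (\<lambda>x\<in>topspace X. 1)"
    using u by (force simp: v_def fun_eq_iff)
  moreover have "(\<lambda>x\<in>topspace X. v x * u x) = (\<lambda>x\<in>topspace X. 1)"
    using u by (force simp: v_def fun_eq_iff)
  ultimately show "u \<in> positive_units X"
    using u by (auto simp: positive_units_def Units_def Cc_def)
qed (auto simp: positive_units_def Units_def Cc_def)

lemma mc_nbhd_self: "g \<in> carrier (Cc X) \<Longrightarrow> u \<in> positive_units X \<Longrightarrow> g \<in> mc_nbhd X g u"
  by (auto simp: mc_nbhd_def positive_units_def)

lemma istopology_mc: "istopology (arbitrary union_of mc_base X)"
  unfolding istopology_base_eq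
proof (intro allI impI, elim conjE)
  fix S T assume S: "mc_base X S" and T: "mc_base X T"
  obtain g u where g: "g \<in> Cc_carrier X" and u: "u \<in> positive_units X" and Seq: "S = mc_nbhd X g u"
    using S by (auto simp: mc_base_def Cc_def)
  obtain h v where h: "h \<in> Cc_carrier X" and v: "v \<in> positive_units X" and Teq: "T = mc_nbhd X h v"
    using T by (auto simp: mc_base_def Cc_def)
  have "\<exists>B. mc_base X B \<and> f \<in> B \<and> B \<subseteq> S \<inter> T" if "f \<in> S \<inter> T" for f
  proof -
    have f: "f \<in> Cc_carrier X"
      and fS: "\<And>x. x \<in> topspace X \<Longrightarrow> \<bar>f x - g x\<bar> < u x"
      and fT: "\<And>x. x \<in> topspace X \<Longrightarrow> \<bar>f x - h x\<bar> < v x"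
      using that by (auto simp: Seq Teq mc_nbhd_def Cc_def)
    define w where "w = (\<lambda>x\<in>topspace X. min (u x - \<bar>f x - g x\<bar>) (v x - \<bar>f x - h x\<bar>))"
    have u': "u \<in> Cc_carrier X" and v': "v \<in> Cc_carrier X"
      using u v by (auto simp: positive_units_iff)
    note C = Cc_carrierD[OF f] Cc_carrierD[OF g] Cc_carrierD[OF h]
      Cc_carrierD[OF u'] Cc_carrierD[OF v']
    have "w \<in> Cc_carrier X"
      unfolding w_def
    proof (rule Cc_carrierI)
      show "continuous_map X euclideanreal (\<lambda>x. min (u x - \<bar>f x - g x\<bar>) (v x - \<bar>f x - h x\<bar>))"
        using C by (intro continuous_intros)
      have "countable ((\<lambda>x. u x - \<bar>f x - g x\<bar>) ` topspace X)"
        using C by (intro countable_image2[of u _ "\<lambda>x. f x - g x" "\<lambda>a b. a - \<bar>b\<bar>"]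
            countable_image2[of f _ g "(-)"])
      moreover have "countable ((\<lambda>x. v x - \<bar>f x - h x\<bar>) ` topspace X)"
        using C by (intro countable_image2[of v _ "\<lambda>x. f x - h x" "\<lambda>a b. a - \<bar>b\<bar>"]
            countable_image2[of f _ h "(-)"])
      ultimately show
        "countable ((\<lambda>x. min (u x - \<bar>f x - g x\<bar>) (v x - \<bar>f x - h x\<bar>)) ` topspace X)"
        by (rule countable_image2[where h = min])
    qed
    moreover have "\<forall>x\<in>topspace X. 0 < w x"
      using fS fT by (auto simp: w_def)
    ultimately have w: "w \<in> positive_units X"
      by (simp add: positive_units_iff)
    have fC: "f \<in> carrier (Cc X)"
      using f by (simp add: Cc_def)
    have "mc_nbhd X f w \<subseteq> S \<inter> T"
      unfolding Seq Teq mc_nbhd_def w_def by fastforce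
    with w fC mc_nbhd_self[OF fC w] show ?thesis
      by (auto simp: mc_base_def)
  qed
  then show "(arbitrary union_of mc_base X) (S \<inter> T)"
    unfolding arbitrary_union_of_alt by blast
qed

lemma openin_mc_topology: "openin (mc_topology X) = arbitrary union_of mc_base X"
  by (simp add: mc_topology_def istopology_mc topology_inverse')

lemma topspace_mc_topology: "topspace (mc_topology X) = carrier (Cc X)"
proof
  show "topspace (mc_topology X) \<subseteq> carrier (Cc X)"
    unfolding topspace_def openin_mc_topology
    by (force simp: union_of_def mc_base_def mc_nbhd_def)
next
  have "f \<in> topspace (mc_topology X)" if f: "f \<in> carrier (Cc X)" for f
  proof -
    have u: "(\<lambda>x\<in>topspace X. 1) \<in> positive_units X"
      by (auto simp: positive_units_iff Cc_const)
    have "openin (mc_topology X) (mc_nbhd X f (\<lambda>x\<in>topspace X. 1))"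
      unfolding openin_mc_topology
      by (rule arbitrary_union_of_inc) (use f u in \<open>auto simp: mc_base_def\<close>)
    then show ?thesis
      using mc_nbhd_self[OF f u] openin_subset by blast
  qed
  then show "carrier (Cc X) \<subseteq> topspace (mc_topology X)"
    by blast
qed

end

theory Submission
  imports Defs "HOL-Algebra.Ring_Divisibility"
begin

text \<open>
  A maximal ideal is \<open>m\<^sub>c\<close>-closed: if \<open>f \<notin> M\<close>, write \<open>1 = m + a f\<close> with \<open>m \<in> M\<close>; any \<open>g\<close> with
  \<open>\<bar>f - g\<bar> \<bar>a\<bar> < 1\<close> makes \<open>m + a g\<close> a unit, so \<open>g \<notin> M\<close>.

  Conversely let \<open>f\<close> lie in every maximal ideal above \<open>I\<close> and let \<open>u\<close> be a positive unit. As \<open>f / u\<close>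
  has countable range, some \<open>0 < c < 1\<close> is not a value of \<open>\<bar>f / u\<bar>\<close>, so \<open>{\<bar>f\<bar> > c u}\<close> is clopen. Its
  indicator \<open>e\<close> is a multiple of \<open>f\<close>, hence lies in every maximal ideal above \<open>I\<close>; being idempotent,
  \<open>e\<close> then lies in \<open>I\<close> itself. Thus \<open>f e \<in> I\<close>, and \<open>\<bar>f - f e\<bar> \<le> c u < u\<close>.
\<close>

section \<open>Maximal ideals and idempotents in commutative rings\<close>

text \<open>Zorn's lemma applies because properness of an ideal is expressed as
  \<open>\<one> \<notin> J\<close>, a condition that survives unions of chains.\<close>

lemma (in cring) exists_maximalideal:
  assumes I: "ideal I R" and "\<one> \<notin> I"
  shows "\<exists>M. maximalideal M R \<and> I \<subseteq> M"
proof -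
  define A where "A = {J. ideal J R \<and> I \<subseteq> J \<and> \<one> \<notin> J}"
  have "\<exists>M\<in>A. \<forall>J\<in>A. M \<subseteq> J \<longrightarrow> J = M"
  proof (rule subset_Zorn_nonempty)
    show "A \<noteq> {}"
      using assms by (auto simp: A_def)
  next
    fix C assume "C \<noteq> {}" and C: "subset.chain A C"
    then have "ideal (\<Union>C) R"
      using chain_Union_is_ideal[of C] by (auto simp: A_def subset.chain_def)
    with \<open>C \<noteq> {}\<close> C show "\<Union>C \<in> A"
      by (auto simp: A_def subset.chain_def)
  qed
  then obtain M where M: "M \<in> A" and max: "\<And>J. J \<in> A \<Longrightarrow> M \<subseteq> J \<Longrightarrow> J = M"
    by blast
  have "maximalideal M R"
  proof (rule maximalidealI)
    fix J assume J: "ideal J R" "M \<subseteq> J"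
    show "J = M \<or> J = carrier R"
      using M max[of J] J ideal.one_imp_carrier[OF J(1)] by (auto simp: A_def)
  qed (use M in \<open>auto simp: A_def\<close>)
  with M show ?thesis
    by (auto simp: A_def)
qed

text \<open>The witness is the sum of \<open>I\<close> and the principal ideal of \<open>d\<close>.
  It serves twice below: with \<open>d = 1 - e\<close> for an idempotent \<open>e\<close>, and with
  an element outside a maximal ideal.\<close>

lemma (in cring) ideal_adjoin:
  assumes I: "ideal I R" and d: "d \<in> carrier R"
  obtains J where "ideal J R" "I \<subseteq> J" "d \<in> J"
    "\<And>x. x \<in> J \<Longrightarrow> \<exists>i\<in>I. \<exists>r\<in>carrier R. x = i \<oplus> r \<otimes> d"
proof
  interpret I: ideal I R by (rule I)
  interpret P: ideal "PIdl d" R by (rule cgenideal_ideal[OF d])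
  show "ideal (I <+>\<^bsub>R\<^esub> PIdl d) R"
    by (intro add_ideals I P.is_ideal)
  show "I \<subseteq> I <+>\<^bsub>R\<^esub> PIdl d"
  proof
    fix i assume i: "i \<in> I"
    then have "i = i \<oplus> \<zero>"
      by (simp add: I.Icarr)
    with i P.zero_closed show "i \<in> I <+>\<^bsub>R\<^esub> PIdl d"
      unfolding set_add_def' by blast
  qed
  have "d = \<zero> \<oplus> d"
    using d by simp
  then show "d \<in> I <+>\<^bsub>R\<^esub> PIdl d"
    using I.zero_closed cgenideal_self[OF d] unfolding set_add_def' by blast
  show "\<exists>i\<in>I. \<exists>r\<in>carrier R. x = i \<oplus> r \<otimes> d" if "x \<in> I <+>\<^bsub>R\<^esub> PIdl d" for x
    using that unfolding set_add_def' cgenideal_def by blast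
qed

text \<open>With \<open>d = 1 - e\<close>, a maximal ideal above \<open>I\<close> and
  \<open>d\<close> would contain both \<open>e\<close> and \<open>d\<close>, hence \<open>1\<close>.
  So \<open>1 = i + r d\<close> with \<open>i\<close> in \<open>I\<close>, and multiplying by
  \<open>e\<close> kills \<open>r d\<close> and leaves \<open>e = i e\<close>.\<close>

lemma (in cring) idempotent_mem_ideal:
  assumes I: "ideal I R" and e: "e \<in> carrier R" "e \<otimes> e = e"
    and hull: "\<And>M. maximalideal M R \<Longrightarrow> I \<subseteq> M \<Longrightarrow> e \<in> M"
  shows "e \<in> I"
proof -
  interpret I: ideal I R by (rule I)
  define d where "d = \<one> \<ominus> e"
  have d: "d \<in> carrier R" and de: "d \<otimes> e = \<zero>" and d1: "d \<oplus> e = \<one>"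
    using e by (simp_all add: d_def minus_eq l_distr l_minus a_assoc l_neg r_neg)
  obtain J where J: "ideal J R" and "I \<subseteq> J" "d \<in> J"
    and Jelem: "\<And>x. x \<in> J \<Longrightarrow> \<exists>i\<in>I. \<exists>r\<in>carrier R. x = i \<oplus> r \<otimes> d"
    using ideal_adjoin[OF I d] by blast
  have "\<one> \<in> J"
  proof (rule ccontr)
    assume "\<one> \<notin> J"
    then obtain M where M: "maximalideal M R" "J \<subseteq> M"
      using exists_maximalideal[OF J] by blast
    interpret M: maximalideal M R by (rule M(1))
    have "e \<in> M" "d \<in> M"
      using hull M \<open>I \<subseteq> J\<close> \<open>d \<in> J\<close> by auto
    then have "\<one> \<in> M"
      using M.a_closed d1 by metis
    then show False
      using M.one_imp_carrier M.I_notcarr by blast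
  qed
  then obtain i r where i: "i \<in> I" and r: "r \<in> carrier R" and one: "\<one> = i \<oplus> r \<otimes> d"
    using Jelem by blast
  have "e = (i \<oplus> r \<otimes> d) \<otimes> e"
    using e one by (metis l_one)
  also have "\<dots> = i \<otimes> e"
    using e(1) d r I.Icarr[OF i] by (simp add: l_distr m_assoc de)
  finally show ?thesis
    using I.I_r_closed[OF i e(1)] by simp
qed

section \<open>Closure in the \<open>m\<^sub>c\<close>-topology as approximation within positive
  units\<close>

lemma carrier_Cc: "carrier (Cc X) = Cc_carrier X"
  by (simp add: Cc_def)

text \<open>An intersection over an empty family would be \<open>UNIV\<close>, so a maximal ideal
  above \<open>I\<close> has to exist first.\<close>

lemma max_ideal_hull_subset_carrier:
  assumes "I \<noteq> carrier (Cc X)" "ideal I (Cc X)"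
  shows "max_ideal_hull X I \<subseteq> carrier (Cc X)"
proof -
  interpret cring "Cc X" by (rule cring_Cc)
  obtain M where M: "maximalideal M (Cc X)" "I \<subseteq> M"
    using exists_maximalideal[OF assms(2)] assms ideal.one_imp_carrier by blast
  interpret M: maximalideal M "Cc X" by (rule M(1))
  show ?thesis
    using M M.Icarr by (auto simp: max_ideal_hull_def)
qed

lemma openin_mc_nbhd:
  assumes "g \<in> carrier (Cc X)" "u \<in> positive_units X"
  shows "openin (mc_topology X) (mc_nbhd X g u)"
  unfolding openin_mc_topology
  by (rule arbitrary_union_of_inc) (use assms in \<open>auto simp: mc_base_def\<close>)

lemma mc_closure_mem_nbhd:
  assumes "f \<in> mc_topology X closure_of S" "u \<in> positive_units X"
  obtains g where "g \<in> S" "g \<in> carrier (Cc X)" "\<And>x. x \<in> topspace X \<Longrightarrow> \<bar>g x - f x\<bar> < u x"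
proof -
  have "f \<in> carrier (Cc X)"
    using assms(1) by (auto simp: in_closure_of topspace_mc_topology)
  then have "openin (mc_topology X) (mc_nbhd X f u)" "f \<in> mc_nbhd X f u"
    using assms(2) by (simp_all add: openin_mc_nbhd mc_nbhd_self)
  then obtain g where "g \<in> S" "g \<in> mc_nbhd X f u"
    using assms(1) unfolding in_closure_of by blast
  then show thesis
    by (intro that) (auto simp: mc_nbhd_def)
qed

text \<open>Neighbourhoods centred at \<open>f\<close> suffice: if \<open>f\<close> lies in
  \<open>mc_nbhd X h v\<close>, the radius \<open>v - \<bar>f - h\<bar>\<close> around
  \<open>f\<close> stays inside, by the triangle inequality.\<close>

lemma mc_closureI:
  assumes f: "f \<in> carrier (Cc X)"
    and approx: "\<And>u. u \<in> positive_units X \<Longrightarrow>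
      \<exists>g\<in>S. g \<in> carrier (Cc X) \<and> (\<forall>x\<in>topspace X. \<bar>g x - f x\<bar> < u x)"
  shows "f \<in> mc_topology X closure_of S"
  unfolding in_closure_of topspace_mc_topology
proof (intro conjI allI impI f, elim conjE)
  fix T assume "f \<in> T" "openin (mc_topology X) T"
  then obtain B where B: "mc_base X B" "f \<in> B" "B \<subseteq> T"
    unfolding openin_mc_topology arbitrary_union_of_alt by blast
  then obtain h v where h: "h \<in> Cc_carrier X" and v: "v \<in> Cc_carrier X"
    and Beq: "B = mc_nbhd X h v"
    by (auto simp: mc_base_def positive_units_iff carrier_Cc)
  define u where "u = (\<lambda>x\<in>topspace X. v x - \<bar>f x - h x\<bar>)"
  have "u \<in> Cc_carrier X"
    unfolding u_def
  proof (rule Cc_carrierI)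
    note C = Cc_carrierD[OF f[unfolded carrier_Cc]] Cc_carrierD[OF h] Cc_carrierD[OF v]
    show "continuous_map X euclideanreal (\<lambda>x. v x - \<bar>f x - h x\<bar>)"
      using C by (intro continuous_intros)
    show "countable ((\<lambda>x. v x - \<bar>f x - h x\<bar>) ` topspace X)"
      using C by (intro countable_image2[of v _ "\<lambda>x. f x - h x" "\<lambda>a b. a - \<bar>b\<bar>"]
          countable_image2[of f _ h "(-)"])
  qed
  then have "u \<in> positive_units X"
    using B by (auto simp: positive_units_iff u_def Beq mc_nbhd_def)
  then obtain g where g: "g \<in> S" "g \<in> carrier (Cc X)"
    and gf: "\<And>x. x \<in> topspace X \<Longrightarrow> \<bar>g x - f x\<bar> < u x"
    using approx by blast
  have "g \<in> B"
    using g gf by (fastforce simp: Beq mc_nbhd_def u_def)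
  with g B show "\<exists>y. y \<in> S \<and> y \<in> T"
    by blast
qed

section \<open>Maximal ideals are closed\<close>

lemma maximalideal_mc_closed:
  assumes "maximalideal M (Cc X)"
  shows "closedin (mc_topology X) M"
proof -
  interpret cring "Cc X" by (rule cring_Cc)
  interpret M: maximalideal M "Cc X" by (rule assms)
  have "f \<in> M" if f: "f \<in> mc_topology X closure_of M" for f
  proof (rule ccontr)
    assume "f \<notin> M"
    have fC: "f \<in> carrier (Cc X)"
      using f by (auto simp: in_closure_of topspace_mc_topology)
    obtain J where J: "ideal J (Cc X)" and "M \<subseteq> J" "f \<in> J"
      and Jelem: "\<And>h. h \<in> J \<Longrightarrow> \<exists>m\<in>M. \<exists>a\<in>carrier (Cc X). h = m \<oplus>\<^bsub>Cc X\<^esub> a \<otimes>\<^bsub>Cc X\<^esub> f"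
      using ideal_adjoin[OF M.is_ideal fC] by blast
    have "J = carrier (Cc X)"
      using M.I_maximal[OF J] ideal.Icarr[OF J] \<open>M \<subseteq> J\<close> \<open>f \<in> J\<close> \<open>f \<notin> M\<close> by blast
    then obtain m a where m: "m \<in> M" and a: "a \<in> carrier (Cc X)"
      and one: "\<one>\<^bsub>Cc X\<^esub> = m \<oplus>\<^bsub>Cc X\<^esub> a \<otimes>\<^bsub>Cc X\<^esub> f"
      using Jelem one_closed by blast
    have one': "m x + a x * f x = 1" if "x \<in> topspace X" for x
      using fun_cong[OF one, of x] that by (simp add: Cc_def)
    \<comment> \<open>This radius forces \<open>\<bar>a (g - f)\<bar> < 1\<close>; the summand
      \<open>1\<close> covers the zeros of \<open>a\<close>.\<close>
    define u where "u = (\<lambda>x\<in>topspace X. 1 / (\<bar>a x\<bar> + 1))"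
    have "u \<in> Cc_carrier X"
      unfolding u_def
    proof (rule Cc_carrierI)
      note C = Cc_carrierD[OF a[unfolded carrier_Cc]]
      show "continuous_map X euclideanreal (\<lambda>x. 1 / (\<bar>a x\<bar> + 1))"
        using C by (intro continuous_intros) auto
      show "countable ((\<lambda>x. 1 / (\<bar>a x\<bar> + 1)) ` topspace X)"
        using C by (intro countable_image2[of a _ a "\<lambda>y z. 1 / (\<bar>y\<bar> + 1)"])
    qed
    then have "u \<in> positive_units X"
      by (auto simp: positive_units_iff u_def)
    then obtain g where g: "g \<in> M" "g \<in> carrier (Cc X)"
      and gf: "\<And>x. x \<in> topspace X \<Longrightarrow> \<bar>g x - f x\<bar> < u x"
      using mc_closure_mem_nbhd[OF f] by blast
    \<comment> \<open>Replacing \<open>f\<close> by \<open>g\<close> in \<open>1 = m + a f\<close>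
      changes the value by \<open>a (g - f)\<close>, so \<open>p\<close> is everywhere positive and
      hence a unit, although it lies in \<open>M\<close>.\<close>
    define p where "p = m \<oplus>\<^bsub>Cc X\<^esub> a \<otimes>\<^bsub>Cc X\<^esub> g"
    have p: "p \<in> M"
      unfolding p_def using m g a by (intro M.a_closed M.I_l_closed)
    have "0 < p x" if x: "x \<in> topspace X" for x
    proof -
      have "\<bar>a x * (g x - f x)\<bar> \<le> (\<bar>a x\<bar> + 1) * \<bar>g x - f x\<bar>"
        unfolding abs_mult by (intro mult_right_mono) auto
      also have "\<dots> < (\<bar>a x\<bar> + 1) * u x"
        using gf[OF x] by (intro mult_strict_left_mono) auto
      also have "\<dots> = 1"
        using x by (simp add: u_def)
      finally have "\<bar>a x * (g x - f x)\<bar> < 1" .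
      moreover have "p x = 1 + a x * (g x - f x)"
        using one'[OF x] x by (simp add: p_def Cc_def algebra_simps)
      ultimately show ?thesis
        by linarith
    qed
    then have "p \<in> Units (Cc X)"
      using M.Icarr[OF p] positive_units_iff[of p X] by (auto simp: carrier_Cc positive_units_def)
    then have "\<one>\<^bsub>Cc X\<^esub> \<in> M"
      using M.I_r_closed[OF p] Units_r_inv Units_inv_closed by metis
    then show False
      using M.one_imp_carrier M.I_notcarr by blast
  qed
  moreover have "M \<subseteq> topspace (mc_topology X)"
    using M.Icarr by (auto simp: topspace_mc_topology)
  ultimately show ?thesis
    by (simp add: closure_of_subset_eq[symmetric] subset_iff)
qed

section \<open>Idempotent multiples of a function with countable range\<close>

text \<open>The factor \<open>k\<close> puts \<open>e\<close> in every ideal containing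
  \<open>f\<close>, and the last estimate makes \<open>e f\<close> the approximant of
  \<open>f\<close>.\<close>

lemma ex_idempotent_multiple:
  assumes f: "f \<in> carrier (Cc X)" and u: "u \<in> positive_units X"
  obtains e k where "e \<in> carrier (Cc X)" "k \<in> carrier (Cc X)" "e = k \<otimes>\<^bsub>Cc X\<^esub> f"
    "e \<otimes>\<^bsub>Cc X\<^esub> e = e" "\<And>x. x \<in> topspace X \<Longrightarrow> \<bar>e x * f x - f x\<bar> < u x"
proof -
  have uC: "u \<in> Cc_carrier X" and upos: "\<And>x. x \<in> topspace X \<Longrightarrow> 0 < u x"
    using u by (auto simp: positive_units_iff)
  note C = Cc_carrierD[OF f[unfolded carrier_Cc]] Cc_carrierD[OF uC]
  have "countable ((\<lambda>x. \<bar>f x\<bar> / u x) ` topspace X)"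
    using C by (intro countable_image2[of f _ u "\<lambda>y z. \<bar>y\<bar> / z"])
  then have "\<not> {0<..<1::real} \<subseteq> (\<lambda>x. \<bar>f x\<bar> / u x) ` topspace X"
    using countable_subset uncountable_open_interval[of 0 "1::real"] by (metis zero_less_one)
  then obtain c where c: "0 < c" "c < 1" "c \<notin> (\<lambda>x. \<bar>f x\<bar> / u x) ` topspace X"
    unfolding subset_iff greaterThanLessThan_iff by blast
  have s: "\<bar>f x\<bar> - c * u x \<noteq> 0" if "x \<in> topspace X" for x
  proof
    assume "\<bar>f x\<bar> - c * u x = 0"
    then have "c = \<bar>f x\<bar> / u x"
      using upos[OF that] by simp
    with c that show False
      by blast
  qed
  \<comment> \<open>\<open>E (f x) (u x)\<close> is the indicator of
    \<open>\<bar>f x\<bar> > c * u x\<close>; the value \<open>1/2\<close> is excluded by the choice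
    of \<open>c\<close>. As a function of the two values \<open>f x\<close> and \<open>u x\<close>
    alone it has countable range.\<close>
  define E where "E = (\<lambda>y z. (1 + sgn (\<bar>y\<bar> - c * z)) / 2 :: real)"
  define e where "e = (\<lambda>x\<in>topspace X. E (f x) (u x))"
  \<comment> \<open>This is \<open>1 / f\<close> where the indicator is \<open>1\<close>, and
    \<open>0\<close> elsewhere. The term \<open>1 - E\<close> keeps the denominator nonzero at the
    zeros of \<open>f\<close>, so one continuous quotient covers both cases.\<close>
  define k where "k = (\<lambda>x\<in>topspace X. E (f x) (u x) * f x / ((f x)\<^sup>2 + (1 - E (f x) (u x))))"
  have E: "c * u x < \<bar>f x\<bar> \<and> E (f x) (u x) = 1 \<or> \<bar>f x\<bar> < c * u x \<and> E (f x) (u x) = 0"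
    if "x \<in> topspace X" for x
    using s[OF that] by (auto simp: E_def sgn_if)
  have nz: "f x \<noteq> 0" if "x \<in> topspace X" "E (f x) (u x) = 1" for x
    using E[OF that(1)] that(2) c(1) upos[OF that(1)] by (auto simp: mult_less_0_iff)
  have den: "(f x)\<^sup>2 + (1 - E (f x) (u x)) \<noteq> 0" if "x \<in> topspace X" for x
    using E[OF that] nz[OF that] by (auto simp: add_nonneg_eq_0_iff)
  have contS: "continuous_map X euclideanreal (\<lambda>x. \<bar>f x\<bar> - c * u x)"
    using C by (intro continuous_intros)
  have contE: "continuous_map X euclideanreal (\<lambda>x. E (f x) (u x))"
  proof -
    \<comment> \<open>\<open>sgn\<close> is continuous away from \<open>0\<close>, and its argument
      never vanishes by \<open>s\<close>.\<close>
    have "continuous_map X euclideanreal (\<lambda>x. sgn (\<bar>f x\<bar> - c * u x))"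
      using contS s by (simp add: continuous_map_atin tendsto_sgn)
    then show ?thesis
      unfolding E_def by (intro continuous_intros) auto
  qed
  have eC: "e \<in> carrier (Cc X)"
    unfolding e_def carrier_Cc using contE C by (intro Cc_carrierI countable_image2[of f _ u E])
  moreover have "k \<in> carrier (Cc X)"
    unfolding k_def carrier_Cc
    using contE C den
    by (intro Cc_carrierI continuous_intros
        countable_image2[of f _ u "\<lambda>y z. E y z * y / (y\<^sup>2 + (1 - E y z))"]) auto
  moreover have "e = k \<otimes>\<^bsub>Cc X\<^esub> f"
    using E nz by (fastforce simp: Cc_def e_def k_def fun_eq_iff power2_eq_square)
  moreover have "e \<otimes>\<^bsub>Cc X\<^esub> e = e"
    using E by (fastforce simp: Cc_def e_def fun_eq_iff)
  moreover have "\<bar>e x * f x - f x\<bar> < u x" if x: "x \<in> topspace X" for x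
  proof -
    have "c * u x < u x"
      using c upos[OF x] by simp
    then have "E (f x) (u x) = 1 \<or> \<bar>f x\<bar> < u x \<and> E (f x) (u x) = 0"
      using E[OF x] less_trans by blast
    then show ?thesis
      using upos[OF x] x by (auto simp: e_def)
  qed
  ultimately show thesis
    using that by blast
qed

theorem theorem3p8:
  fixes X :: "'a topology" and I :: "('a \<Rightarrow> real) set"
  assumes "zero_dimensional_space X" and "Hausdorff_space X"
    and "ideal I (Cc X)" and "I \<noteq> carrier (Cc X)"
  shows "mc_topology X closure_of I = max_ideal_hull X I"
proof
  interpret cring "Cc X" by (rule cring_Cc)
  show "mc_topology X closure_of I \<subseteq> max_ideal_hull X I"
    \<comment> \<open>Each maximal ideal above \<open>I\<close> is closed, so it contains the
      closure of \<open>I\<close>.\<close>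
    by (auto simp: max_ideal_hull_def dest: closure_of_minimal[OF _ maximalideal_mc_closed])
  show "max_ideal_hull X I \<subseteq> mc_topology X closure_of I"
  proof
    fix f assume f: "f \<in> max_ideal_hull X I"
    then have fC: "f \<in> carrier (Cc X)"
      using max_ideal_hull_subset_carrier assms by blast
    interpret I: ideal I "Cc X" by fact
    show "f \<in> mc_topology X closure_of I"
    proof (rule mc_closureI[OF fC])
      fix u assume "u \<in> positive_units X"
      then obtain e k where e: "e \<in> carrier (Cc X)" and k: "k \<in> carrier (Cc X)"
        and ekf: "e = k \<otimes>\<^bsub>Cc X\<^esub> f" and ee: "e \<otimes>\<^bsub>Cc X\<^esub> e = e"
        and near: "\<And>x. x \<in> topspace X \<Longrightarrow> \<bar>e x * f x - f x\<bar> < u x"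
        using ex_idempotent_multiple[OF fC] by blast
      have "e \<in> I"
      proof (rule idempotent_mem_ideal[OF assms(3) e ee])
        fix M assume M: "maximalideal M (Cc X)" "I \<subseteq> M"
        then have "f \<in> M"
          using f by (auto simp: max_ideal_hull_def)
        then show "e \<in> M"
          using ideal.I_l_closed[OF maximalideal.axioms(1)[OF M(1)]] k ekf by simp
      qed
      then have "e \<otimes>\<^bsub>Cc X\<^esub> f \<in> I"
        using fC by (rule I.I_r_closed)
      moreover have "\<forall>x\<in>topspace X. \<bar>(e \<otimes>\<^bsub>Cc X\<^esub> f) x - f x\<bar> < u x"
        using near by (simp add: Cc_def)
      ultimately show "\<exists>g\<in>I. g \<in> carrier (Cc X) \<and> (\<forall>x\<in>topspace X. \<bar>g x - f x\<bar> < u x)"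
        using I.Icarr by blast
    qed
  qed
qed

end
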